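(* Let $\mathcal{A}$ be a countable alphabet, let $X$ and $Y$ be shift spaces over $\mathcal{A}$, and suppose that $X$ is row-finite. If $\psi:X\to Y$ is an $M$-block code ($M\in\mathbb{N}$), and if $X^{[M]}$ denotes the $M$th higher block presentation of $X$ and $\phi_M:X\to X^{[M]}$ denotes the $M$th higher block code from $X$ to $X^{[M]}$, then there exists a $1$-block code $\psi^{[M]}:X^{[M]}\to Y$ such that $\psi^{[M]}\circ\phi_M=\psi$.
   Context: "Countable" means finite or countably infinite; $\mathbb{N}=\{1,2,\ldots\}$. For an alphabet $\mathcal{A}$, let $\mathcal{A}^0=\{\vec{0}\}$ ($\vec{0}$ the empty sequence), $\Sigma_{\mathcal{A}}^{\mathrm{fin}}=\bigcup_{k=0}^\infty\mathcal{A}^k$ and $\Sigma_{\mathcal{A}}^{\mathrm{inf}}=\mathcal{A}^{\mathbb{N}}$; $l(x)$ is the length. If $\mathcal{A}$ is infinite, $\Sigma_{\mathcal{A}}:=\Sigma_{\mathcal{A}}^{\mathrm{inf}}\sqcup\Sigma_{\mathcal{A}}^{\mathrm{fin}}$ with the quotient topology from the map $Q:\mathcal{A}_\infty\times\mathcal{A}_\infty\times\cdots\to\Sigma_{\mathcal{A}}$ that truncates a sequence just before the first occurrence of $\infty$, where $\mathcal{A}_\infty=\mathcal{A}\cup\{\infty\}$ is the one-point compactification of the discrete space $\mathcal{A}$ and the product has the product topology. If $\mathcal{A}$ is finite, $\Sigma_{\mathcal{A}}:=\mathcal{A}^{\mathbb{N}}$ with the product topology. The shift map $\sigma$ deletes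 the first entry, with $\sigma(x)=\vec 0$ when $l(x)\le 1$. A shift space over $\mathcal{A}$ is a closed set $X\subseteq\Sigma_{\mathcal{A}}$ with $\sigma(X)\subseteq X$ having the infinite-extension property: for each $x\in X$ with $l(x)<\infty$ there are infinitely many $a\in\mathcal{A}$ with $xay\in X$ for some $y\in\Sigma_{\mathcal{A}}$. $X^{\mathrm{inf}}=X\cap\Sigma_{\mathcal{A}}^{\mathrm{inf}}$. $B(X)$ is the set of finite blocks occurring as subblocks of elements of $X$, and $B_n(X)=B(X)\cap\mathcal{A}^n$. $X$ is row-finite if for every $a\in\mathcal{A}$ the set $\{b\in\mathcal{A}:ab\in B(X)\}$ is finite; every element of a row-finite shift space is either infinite or equal to $\vec{0}$. Block codes: let $X$ be a row-finite shift space over a countable alphabet $\mathcal{A}$ and $Y$ a shift space over a countable alphabet $\mathcal{B}$. For $N\in\mathbb{N}$, a map $\phi:X\to Y$ is an $N$-block code if (a) whenever $\{x^n\}_{n=1}^\infty\subseteq X$ and $\lim_n x^n=\vec{0}$, then $\lim_n\phi(x^n)=\vec{0}$, and (b) there is a map $\Phi:B_N(X)\to\mathcal{B}$ with $\phi(x_1x_2\ldots)_i=\Phi(x_i\ldots x_{N+i-1})$ for all $i\in\mathbb{N}$ and all $x_1x_2\ldots\in X^{\mathrm{inf}}$. Higher block presentation: for a row-finite shift space $X$ over $\mathcal{A}$ and $N\in\mathbb{N}$, regard $B_N(X)$ as an alphabet. The $N$th higher block code $\phi_N:X\to\Sigma_{B_N(X)}$ is given by $(\phi_N(x))_i=x_ix_{i+1}\ldots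 x_{i+N-1}$ for all $i\in\mathbb{N}$ if $x\ne\vec{0}$, and $\phi_N(\vec{0})=\vec{0}$. The $N$th higher block presentation is $X^{[N]}:=\phi_N(X)$; it is a row-finite shift space over $B_N(X)$. *)

theory Defs
  imports "HOL-Analysis.Analysis"
begin

text \<open>
  Positions in sequences are numbered from 0, so \<open>InfSeq x\<close> stands for the sequence whose
  \<open>i\<close>-th entry in the usual numbering \<open>1, 2, \<dots>\<close> is \<open>x (i - 1)\<close>; \<open>FinSeq []\<close> is the empty
  sequence. An alphabet is a set of elements of the type parameter, which need not be all of it.
\<close>

datatype 'a fiseq = FinSeq "'a list" | InfSeq "nat \<Rightarrow> 'a"

definition full_shift :: "'a set \<Rightarrow> 'a fiseq set" where
  "full_shift A =
     (if finite A then InfSeq ` (UNIV \<rightarrow> A) else InfSeq ` (UNIV \<rightarrow> A) \<union> FinSeq ` lists A)"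

text \<open>The set \<open>f ` topspace T\<close> with the finest topology making \<open>f\<close> continuous.\<close>

definition quotient_topology :: "'b topology \<Rightarrow> ('b \<Rightarrow> 'c) \<Rightarrow> 'c topology" where
  "quotient_topology T f =
     topology (\<lambda>U. U \<subseteq> f ` topspace T \<and> openin T {x \<in> topspace T. f x \<in> U})"

lemma openin_quotient_topology:
  "openin (quotient_topology T f) U \<longleftrightarrow>
     U \<subseteq> f ` topspace T \<and> openin T {x \<in> topspace T. f x \<in> U}"
proof -
  have "istopology (\<lambda>U. U \<subseteq> f ` topspace T \<and> openin T {x \<in> topspace T. f x \<in> U})"
    unfolding istopology_def
  proof (intro conjI allI impI)
    fix S U
    assume "S \<subseteq> f ` topspace T \<and> openin T {x \<in> topspace T. f x \<in> S}"
      and "U \<subseteq> f ` topspace T \<and> openin T {x \<in> topspace T. f x \<in> U}"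
    moreover have "{x \<in> topspace T. f x \<in> S \<inter> U}
        = {x \<in> topspace T. f x \<in> S} \<inter> {x \<in> topspace T. f x \<in> U}"
      by auto
    ultimately show "S \<inter> U \<subseteq> f ` topspace T" "openin T {x \<in> topspace T. f x \<in> S \<inter> U}"
      by (auto simp only: openin_Int)
  next
    fix K
    assume *: "\<forall>S\<in>K. S \<subseteq> f ` topspace T \<and> openin T {x \<in> topspace T. f x \<in> S}"
    then show "\<Union>K \<subseteq> f ` topspace T"
      by auto
    have "{x \<in> topspace T. f x \<in> \<Union>K} = (\<Union>S\<in>K. {x \<in> topspace T. f x \<in> S})"
      by auto
    then show "openin T {x \<in> topspace T. f x \<in> \<Union>K}"
      using * by auto
  qed
  then show ?thesis
    by (simp add: quotient_topology_def topology_inverse')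
qed

lemma topspace_quotient_topology [simp]:
  "topspace (quotient_topology T f) = f ` topspace T"
proof
  show "topspace (quotient_topology T f) \<subseteq> f ` topspace T"
    by (metis openin_quotient_topology openin_topspace)
  have "{x \<in> topspace T. f x \<in> f ` topspace T} = topspace T"
    by auto
  then have "openin (quotient_topology T f) (f ` topspace T)"
    by (simp add: openin_quotient_topology)
  then show "f ` topspace T \<subseteq> topspace (quotient_topology T f)"
    by (rule openin_subset)
qed

lemma quotient_map_quotient_topology: "quotient_map T (quotient_topology T f) f"
  by (simp add: quotient_map_def openin_quotient_topology)

text \<open>
  The point at infinity of the library's one-point compactification is \<open>None\<close>.
\<close>

definition truncate_seq :: "(nat \<Rightarrow> 'a option) \<Rightarrow> 'a fiseq" where
  "truncate_seq p =
     (if \<exists>n. p n = None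
      then FinSeq (map (\<lambda>i. the (p i)) [0..<(LEAST n. p n = None)])
      else InfSeq (\<lambda>i. the (p i)))"

text \<open>
  For a finite alphabet the map \<open>InfSeq\<close> is injective, so the quotient topology is just the
  product topology carried over to the type of finite or infinite sequences.
\<close>

definition full_shift_topology :: "'a set \<Rightarrow> 'a fiseq topology" where
  "full_shift_topology A =
     (if finite A
      then quotient_topology (product_topology (\<lambda>_. discrete_topology A) UNIV) InfSeq
      else quotient_topology
             (product_topology (\<lambda>_. Alexandroff_compactification (discrete_topology A)) UNIV)
             truncate_seq)"

lemma topspace_full_shift_topology: "topspace (full_shift_topology A) = full_shift A"
proof (cases "finite A")
  case True
  then show ?thesis
    by (simp add: full_shift_topology_def full_shift_def PiE_UNIV_domain)
next
  case False
  let ?P = "UNIV \<rightarrow> insert None (Some ` A) :: (nat \<Rightarrow> 'a option) set"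
  have the_in: "the (p i) \<in> A" if "p \<in> ?P" "p i \<noteq> None" for p i
  proof -
    have "p i \<in> insert None (Some ` A)"
      using that(1) by (simp only: Pi_iff UNIV_I)
    then show ?thesis
      using that(2) by auto
  qed
  have "truncate_seq p \<in> InfSeq ` (UNIV \<rightarrow> A) \<union> FinSeq ` lists A" if p: "p \<in> ?P" for p
  proof (cases "\<exists>n. p n = None")
    case True
    have "the (p i) \<in> A" if "i < (LEAST n. p n = None)" for i
      using not_less_Least[OF that] the_in[OF p] by blast
    then have "map (\<lambda>i. the (p i)) [0..<(LEAST n. p n = None)] \<in> lists A"
      by auto
    then show ?thesis
      using True unfolding truncate_seq_def by (subst if_P) blast+
  next
    case False
    then have "the (p i) \<in> A" for i
      using the_in[OF p] by blast
    then have "(\<lambda>i. the (p i)) \<in> UNIV \<rightarrow> A"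
      by auto
    then show ?thesis
      using False unfolding truncate_seq_def by (subst if_not_P) blast+
  qed
  moreover have "InfSeq x \<in> truncate_seq ` ?P" if "x \<in> UNIV \<rightarrow> A" for x
    by (rule image_eqI[of _ _ "\<lambda>i. Some (x i)"]) (use that in \<open>auto simp: truncate_seq_def\<close>)
  moreover have "FinSeq u \<in> truncate_seq ` ?P" if u: "u \<in> lists A" for u
  proof (rule image_eqI)
    let ?p = "\<lambda>i. if i < length u then Some (u ! i) else None"
    have "(LEAST n. ?p n = None) = length u"
      by (rule Least_equality) (auto split: if_splits)
    then have "truncate_seq ?p = FinSeq (map (\<lambda>i. the (?p i)) [0..<length u])"
      unfolding truncate_seq_def by (subst if_P) (auto intro!: exI[of _ "length u"])
    also have "map (\<lambda>i. the (?p i)) [0..<length u] = u"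
      by (rule nth_equalityI) auto
    finally show "FinSeq u = truncate_seq ?p" ..
    show "?p \<in> ?P"
      using u by (auto simp: in_lists_conv_set)
  qed
  ultimately have "truncate_seq ` ?P = InfSeq ` (UNIV \<rightarrow> A) \<union> FinSeq ` lists A"
    by blast
  then show ?thesis
    using False by (simp add: full_shift_topology_def full_shift_def PiE_UNIV_domain)
qed

fun shift :: "'a fiseq \<Rightarrow> 'a fiseq" where
  "shift (FinSeq u) = FinSeq (tl u)"
| "shift (InfSeq x) = InfSeq (\<lambda>i. x (Suc i))"

fun prepend :: "'a list \<Rightarrow> 'a fiseq \<Rightarrow> 'a fiseq" where
  "prepend w (FinSeq u) = FinSeq (w @ u)"
| "prepend w (InfSeq x) = InfSeq (\<lambda>i. if i < length w then w ! i else x (i - length w))"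

definition shift_space :: "'a set \<Rightarrow> 'a fiseq set \<Rightarrow> bool" where
  "shift_space A X \<longleftrightarrow>
     closedin (full_shift_topology A) X \<and>
     shift ` X \<subseteq> X \<and>
     (\<forall>u. FinSeq u \<in> X \<longrightarrow>
        infinite {a \<in> A. \<exists>y \<in> full_shift A. prepend u (prepend [a] y) \<in> X})"

definition blocks :: "'a fiseq set \<Rightarrow> 'a list set" where
  "blocks X = {u. \<exists>w y. prepend w (prepend u y) \<in> X}"

definition nblocks :: "nat \<Rightarrow> 'a fiseq set \<Rightarrow> 'a list set" where
  "nblocks n X = {u \<in> blocks X. length u = n}"

definition row_finite :: "'a set \<Rightarrow> 'a fiseq set \<Rightarrow> bool" where
  "row_finite A X \<longleftrightarrow> (\<forall>a\<in>A. finite {b \<in> A. [a, b] \<in> blocks X})"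

lemma prepend_append: "prepend v (prepend w y) = prepend (v @ w) y"
  by (cases y) (auto simp: fun_eq_iff nth_append)

lemma row_finite_FinSeq_eq_Nil:
  assumes X: "shift_space A X" "row_finite A X" and u: "FinSeq u \<in> X"
  shows "u = []"
proof (rule ccontr)
  assume "u \<noteq> []"
  then have u_eq: "u = butlast u @ [last u]"
    by simp
  have "FinSeq u \<in> full_shift A"
    using X(1) u closedin_subset topspace_full_shift_topology unfolding shift_space_def by blast
  then have "last u \<in> A"
    using \<open>u \<noteq> []\<close> by (auto simp: full_shift_def in_lists_conv_set split: if_splits)
  have "[last u, a] \<in> blocks X" if "prepend u (prepend [a] y) \<in> X" for a y
  proof -
    have "prepend (butlast u) (prepend [last u, a] y) = prepend u (prepend [a] y)"
      by (subst (2) u_eq) (simp only: prepend_append append.simps append_assoc)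
    then show ?thesis
      unfolding blocks_def using that by (metis (mono_tags, lifting) mem_Collect_eq)
  qed
  then have "{a \<in> A. \<exists>y \<in> full_shift A. prepend u (prepend [a] y) \<in> X}
      \<subseteq> {b \<in> A. [last u, b] \<in> blocks X}"
    by blast
  moreover have "finite {b \<in> A. [last u, b] \<in> blocks X}"
    using X(2) \<open>last u \<in> A\<close> by (simp add: row_finite_def)
  ultimately show False
    using X(1) u finite_subset unfolding shift_space_def by blast
qed

text \<open>
  A block code from \<open>X\<close> (over \<open>A\<close>) to \<open>Y\<close> (over \<open>B\<close>); the standing assumptions on \<open>X\<close>, \<open>Y\<close> and
  their alphabets are part of the notion. The list \<open>map x [i..<i + N]\<close> is the block
  of length \<open>N\<close> starting at position \<open>i\<close>. As \<open>\<phi>\<close> is a total function, only its values on \<open>X\<close> matter.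
  If the empty sequence does not belong to a full shift, no sequence converges to it there.
\<close>

definition block_code ::
  "nat \<Rightarrow> 'a set \<Rightarrow> 'a fiseq set \<Rightarrow> 'b set \<Rightarrow> 'b fiseq set \<Rightarrow> ('a fiseq \<Rightarrow> 'b fiseq) \<Rightarrow> bool" where
  "block_code N A X B Y \<phi> \<longleftrightarrow>
     1 \<le> N \<and>
     countable A \<and> shift_space A X \<and> row_finite A X \<and>
     countable B \<and> shift_space B Y \<and>
     \<phi> \<in> X \<rightarrow> Y \<and>
     (\<forall>xs. range xs \<subseteq> X \<and> limitin (full_shift_topology A) xs (FinSeq []) sequentially \<longrightarrow>
        limitin (full_shift_topology B) (\<lambda>n. \<phi> (xs n)) (FinSeq []) sequentially) \<and>
     (\<exists>\<Phi>. \<Phi> \<in> nblocks N X \<rightarrow> B \<and>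
        (\<forall>x. InfSeq x \<in> X \<longrightarrow> \<phi> (InfSeq x) = InfSeq (\<lambda>i. \<Phi> (map x [i..<i + N]))))"

text \<open>
  By \<open>row_finite_FinSeq_eq_Nil\<close> the only finite sequence the first equation is ever used for,
  with a row-finite shift space, is the empty one.
\<close>

fun higher_block_code :: "nat \<Rightarrow> 'a fiseq \<Rightarrow> 'a list fiseq" where
  "higher_block_code N (FinSeq u) = FinSeq []"
| "higher_block_code N (InfSeq x) = InfSeq (\<lambda>i. map x [i..<i + N])"

text \<open>A set of sequences over the alphabet \<open>nblocks N X\<close>.\<close>

definition higher_block_presentation :: "nat \<Rightarrow> 'a fiseq set \<Rightarrow> 'a list fiseq set" where
  "higher_block_presentation N X = higher_block_code N ` X"

end

theory Submission
  imports Defs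
begin

text \<open>
  The higher block code \<open>\<phi>\<^sub>M\<close> is injective on \<open>X\<close>, so \<open>\<psi> \<circ> \<phi>\<^sub>M\<inverse>\<close> is the only candidate; if \<open>\<Phi>\<close> is the
  block map of \<open>\<psi>\<close>, it reads off \<open>\<Phi>\<close> from a single letter of the higher block presentation.
  A sequence tends to \<open>FinSeq []\<close> iff its initial letters eventually leave every finite set: by compactness
  of the product, the initial letters of the complement of a neighbourhood of \<open>FinSeq []\<close> form a
  finite set. As \<open>X\<close> is row-finite, only finitely many \<open>M\<close>-blocks start with a given letter, so
  \<open>\<phi>\<^sub>M\<inverse>\<close> preserves convergence to \<open>FinSeq []\<close>. For the same reason, closedness of the
  presentation reduces to a condition on initial segments of infinite sequences, together with \<open>FinSeq []\<close>
  belonging to the presentation when there are infinitely many \<open>M\<close>-blocks.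
\<close>

section \<open>Truncation and initial letters\<close>

text \<open>The value \<open>None\<close> at the empty sequence matches the point at infinity:
  composed with \<open>truncate_seq\<close>, this map is the projection of the product to coordinate
  0.\<close>

fun initial :: "'a fiseq \<Rightarrow> 'a option" where
  "initial (FinSeq u) = (if u = [] then None else Some (hd u))"
| "initial (InfSeq x) = Some (x 0)"

lemma truncate_seq_infinite: "truncate_seq (\<lambda>i. Some (x i)) = InfSeq x"
  by (simp add: truncate_seq_def)

lemma truncate_seq_eq_InfSeq_iff: "truncate_seq p = InfSeq x \<longleftrightarrow> p = (\<lambda>i. Some (x i))"
proof
  assume x: "truncate_seq p = InfSeq x"
  then have "\<forall>n. p n \<noteq> None" and "x = (\<lambda>i. the (p i))"
    by (auto simp: truncate_seq_def split: if_splits)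
  then show "p = (\<lambda>i. Some (x i))"
    by auto
qed (simp add: truncate_seq_infinite)

lemma truncate_seq_eq_FinSeqD:
  assumes "truncate_seq p = FinSeq u"
  shows "p (length u) = None" "i < length u \<Longrightarrow> p i = Some (u ! i)"
proof -
  have ex: "\<exists>n. p n = None"
    using assms by (auto simp: truncate_seq_def split: if_splits)
  then have u: "u = map (\<lambda>i. the (p i)) [0..<(LEAST n. p n = None)]"
    using assms by (simp add: truncate_seq_def)
  show "p (length u) = None"
    using LeastI_ex[OF ex] u by simp
  show "p i = Some (u ! i)" if "i < length u"
    using not_less_Least[of i "\<lambda>n. p n = None"] that u by (cases "p i") auto
qed

lemma initial_truncate_seq: "initial (truncate_seq p) = p 0"
proof (cases "truncate_seq p")
  case (FinSeq u)
  then show ?thesis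
    using truncate_seq_eq_FinSeqD[OF FinSeq] by (cases u) auto
next
  case (InfSeq x)
  then show ?thesis
    by (simp add: truncate_seq_eq_InfSeq_iff truncate_seq_infinite)
qed

lemma truncate_seq_eq_Nil_iff: "truncate_seq p = FinSeq [] \<longleftrightarrow> p 0 = None"
proof
  assume "p 0 = None"
  then show "truncate_seq p = FinSeq []"
    using initial_truncate_seq[of p] by (cases "truncate_seq p") (auto split: if_splits)
qed (use initial_truncate_seq[of p] in auto)

section \<open>Cylinders and open sets of the full shift\<close>

lemma openin_product_cylinder:
  assumes "\<And>i. i < n \<Longrightarrow> openin T (V i)"
  shows "openin (product_topology (\<lambda>_::nat. T) UNIV) {q \<in> UNIV \<rightarrow> topspace T. \<forall>i<n. q i \<in> V i}"
proof -
  have eq: "{q \<in> UNIV \<rightarrow> topspace T. \<forall>i<n. q i \<in> V i}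
      = PiE UNIV (\<lambda>i. if i < n then V i else topspace T)"
    using openin_subset[OF assms] by (fastforce simp: PiE_UNIV_domain Pi_iff split: if_splits)
  have "finite {i. (if i < n then V i else topspace T) \<noteq> topspace T}"
    by (rule finite_subset[of _ "{..<n}"]) (auto split: if_splits)
  then have "openin (product_topology (\<lambda>_. T) UNIV) (PiE UNIV (\<lambda>i. if i < n then V i else topspace T))"
    unfolding openin_PiE_gen using assms by simp
  then show ?thesis
    by (simp only: eq)
qed

text \<open>A basic open box around \<open>p\<close> inside \<open>V\<close> restricts only finitely
  many coordinates, and any strict upper bound of these serves as \<open>n\<close>.\<close>

lemma openin_product_contains_cylinder:
  assumes "openin (product_topology (\<lambda>_::nat. T) UNIV) V" and "p \<in> V"
  obtains n where "\<And>q. q \<in> UNIV \<rightarrow> topspace T \<Longrightarrow> \<forall>i<n. q i = p i \<Longrightarrow> q \<in> V"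
proof -
  obtain U where fin: "finite {i. U i \<noteq> topspace T}" and p: "p \<in> PiE UNIV U" and sub: "PiE UNIV U \<subseteq> V"
    using assms unfolding openin_product_topology_alt by fastforce
  obtain n where n: "\<And>i. U i \<noteq> topspace T \<Longrightarrow> i < n"
    using fin finite_nat_bounded[OF fin] by auto
  have "q \<in> V" if q: "q \<in> UNIV \<rightarrow> topspace T" "\<forall>i<n. q i = p i" for q
  proof -
    have "q i \<in> U i" for i
      using n[of i] q p by (cases "i < n") (auto simp: PiE_UNIV_domain Pi_iff)
    then show ?thesis
      using sub by (auto simp: PiE_UNIV_domain)
  qed
  then show thesis
    by (rule that)
qed

lemma openin_Alexandroff_discrete_Some:
  "a \<in> A \<Longrightarrow> openin (Alexandroff_compactification (discrete_topology A)) {Some a}"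
  by (auto simp: openin_Alexandroff_compactification)

text \<open>Complements of compact sets are the neighbourhoods of infinity, and finite sets are
  compact.\<close>

lemma openin_Alexandroff_discrete_cofinite:
  "finite F \<Longrightarrow> F \<subseteq> A \<Longrightarrow>
    openin (Alexandroff_compactification (discrete_topology A)) (insert None (Some ` (A - F)))"
  by (auto simp: openin_Alexandroff_compactification compactin_discrete_topology)

lemma openin_full_shift_infinite:
  assumes "infinite A"
  shows "openin (full_shift_topology A) U \<longleftrightarrow> U \<subseteq> full_shift A \<and>
    openin (product_topology (\<lambda>_. Alexandroff_compactification (discrete_topology A)) UNIV)
      {p \<in> UNIV \<rightarrow> insert None (Some ` A). truncate_seq p \<in> U}"
proof -
  have "truncate_seq ` topspace (product_topology (\<lambda>_. Alexandroff_compactification (discrete_topology A)) UNIV)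
     = full_shift A"
    using topspace_full_shift_topology[of A] assms by (simp add: full_shift_topology_def)
  then show ?thesis
    using assms by (simp add: full_shift_topology_def openin_quotient_topology PiE_UNIV_domain)
qed

lemma openin_full_shift_finite:
  assumes "finite A"
  shows "openin (full_shift_topology A) U \<longleftrightarrow> U \<subseteq> full_shift A \<and>
    openin (product_topology (\<lambda>_. discrete_topology A) UNIV) {x \<in> UNIV \<rightarrow> A. InfSeq x \<in> U}"
proof -
  have "InfSeq ` topspace (product_topology (\<lambda>_. discrete_topology A) UNIV) = full_shift A"
    using topspace_full_shift_topology[of A] assms by (simp add: full_shift_topology_def)
  then show ?thesis
    using assms by (simp add: full_shift_topology_def openin_quotient_topology PiE_UNIV_domain)
qed

lemma InfSeq_in_full_shift [simp]: "InfSeq x \<in> full_shift A \<longleftrightarrow> x \<in> UNIV \<rightarrow> A"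
  by (auto simp: full_shift_def)

lemma FinSeq_in_full_shift [simp]: "FinSeq u \<in> full_shift A \<longleftrightarrow> infinite A \<and> set u \<subseteq> A"
  by (auto simp: full_shift_def in_lists_conv_set)

text \<open>For an infinite alphabet, the only point of the product that truncates to
  \<open>InfSeq x\<close> is \<open>\<lambda>i. Some (x i)\<close>, so a cylinder around this point
  inside the preimage of \<open>U\<close> is enough.\<close>

lemma full_shift_neighbourhood_InfSeq:
  assumes U: "openin (full_shift_topology A) U" and x: "InfSeq x \<in> U"
  obtains n where "\<And>y. y \<in> UNIV \<rightarrow> A \<Longrightarrow> \<forall>i<n. y i = x i \<Longrightarrow> InfSeq y \<in> U"
proof -
  have xA: "x \<in> UNIV \<rightarrow> A"
    using openin_subset[OF U] x unfolding topspace_full_shift_topology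
    by (metis InfSeq_in_full_shift subsetD)
  show thesis
  proof (cases "finite A")
    case True
    have V: "openin (product_topology (\<lambda>_. discrete_topology A) UNIV) {x \<in> UNIV \<rightarrow> A. InfSeq x \<in> U}"
      using U True by (simp add: openin_full_shift_finite)
    obtain n where "\<And>q. q \<in> UNIV \<rightarrow> A \<Longrightarrow> \<forall>i<n. q i = x i \<Longrightarrow> q \<in> {x \<in> UNIV \<rightarrow> A. InfSeq x \<in> U}"
      using openin_product_contains_cylinder[OF V, of x] xA x by auto
    then show thesis
      by (intro that) blast
  next
    case False
    let ?V = "{p \<in> UNIV \<rightarrow> insert None (Some ` A). truncate_seq p \<in> U}"
    have V: "openin (product_topology (\<lambda>_. Alexandroff_compactification (discrete_topology A)) UNIV) ?V"
      using U False by (simp add: openin_full_shift_infinite)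
    have "(\<lambda>i. Some (x i)) \<in> ?V"
      using xA x by (auto simp: truncate_seq_infinite)
    then obtain n where n: "\<And>q. q \<in> UNIV \<rightarrow> insert None (Some ` A) \<Longrightarrow> \<forall>i<n. q i = Some (x i) \<Longrightarrow> q \<in> ?V"
      using openin_product_contains_cylinder[OF V, of "\<lambda>i. Some (x i)"] by auto
    show thesis
    proof (rule that)
      fix y assume "y \<in> UNIV \<rightarrow> A" "\<forall>i<n. y i = x i"
      then have "(\<lambda>i. Some (y i)) \<in> ?V"
        by (intro n) auto
      then show "InfSeq y \<in> U"
        by (simp add: truncate_seq_infinite)
    qed
  qed
qed

text \<open>Otherwise the open complement of \<open>C\<close> would contain all infinite sequences
  of some cylinder around \<open>x\<close>, yet \<open>approx\<close> puts a member of
  \<open>C\<close> there.\<close>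

lemma closedin_full_shift_approx:
  assumes C: "closedin (full_shift_topology A) C" and x: "x \<in> UNIV \<rightarrow> A"
    and approx: "\<And>n. \<exists>y. InfSeq y \<in> C \<and> (\<forall>i<n. y i = x i)"
  shows "InfSeq x \<in> C"
proof (rule ccontr)
  assume "InfSeq x \<notin> C"
  moreover have sub: "C \<subseteq> full_shift A"
    and op: "openin (full_shift_topology A) (full_shift A - C)"
    using C by (auto simp: closedin_def topspace_full_shift_topology)
  ultimately obtain n where
    n: "\<And>y. y \<in> UNIV \<rightarrow> A \<Longrightarrow> \<forall>i<n. y i = x i \<Longrightarrow> InfSeq y \<in> full_shift A - C"
    using full_shift_neighbourhood_InfSeq[OF op, of x] x by (metis DiffI InfSeq_in_full_shift)
  obtain y where "InfSeq y \<in> C" "\<forall>i<n. y i = x i"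
    using approx by blast
  then show False
    using n[of y] sub by (metis DiffD2 InfSeq_in_full_shift subsetD)
qed

section \<open>Convergence to the empty sequence\<close>

text \<open>The points of the product that truncate outside \<open>U\<close> form a closed, hence
  compact set. Its projection to coordinate 0 is compact and misses \<open>None\<close>, because a
  sequence starting with \<open>None\<close> truncates to \<open>FinSeq []\<close>. A compact set of
  isolated points is finite.\<close>

lemma full_shift_neighbourhood_Nil:
  assumes U: "openin (full_shift_topology A) U" and Nil: "FinSeq [] \<in> U"
  obtains F where "finite F" "F \<subseteq> A" "\<And>z. z \<in> full_shift A \<Longrightarrow> initial z \<notin> Some ` F \<Longrightarrow> z \<in> U"
proof -
  let ?K = "Alexandroff_compactification (discrete_topology A)"
  let ?P = "product_topology (\<lambda>_::nat. ?K) UNIV"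
  let ?C = "{p \<in> UNIV \<rightarrow> insert None (Some ` A). truncate_seq p \<notin> U}"
  have A: "infinite A"
    using openin_subset[OF U] Nil by (auto simp: topspace_full_shift_topology)
  have eq: "?C = topspace ?P - {p \<in> UNIV \<rightarrow> insert None (Some ` A). truncate_seq p \<in> U}"
    by (auto simp: PiE_UNIV_domain)
  have "openin ?P {p \<in> UNIV \<rightarrow> insert None (Some ` A). truncate_seq p \<in> U}"
    using U by (simp only: openin_full_shift_infinite[OF A])
  then have "closedin ?P ?C"
    unfolding eq by (rule closedin_diff[OF closedin_topspace])
  moreover have "compact_space ?P"
    by (simp add: compact_space_product_topology compact_space_Alexandroff_compactification)
  ultimately have "compactin ?P ?C"
    by (simp add: closedin_compact_space)
  then have compact: "compactin ?K ((\<lambda>p. p 0) ` ?C)"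
    by (rule image_compactin)
      (use continuous_map_product_projection[of 0 UNIV "\<lambda>_::nat. ?K"] in simp)
  \<comment> \<open>The singletons of letters are open; a finite subcover yields the set
    \<open>F\<close>.\<close>
  have cover: "(\<lambda>p. p 0) ` ?C \<subseteq> \<Union> ((\<lambda>a. {Some a}) ` A)"
  proof clarify
    fix p assume p: "p \<in> UNIV \<rightarrow> insert None (Some ` A)" "truncate_seq p \<notin> U"
    then have "p 0 \<noteq> None"
      using Nil by (metis truncate_seq_eq_Nil_iff)
    moreover have "p 0 \<in> insert None (Some ` A)"
      using p(1) by (simp only: Pi_iff UNIV_I)
    ultimately show "p 0 \<in> \<Union> ((\<lambda>a. {Some a}) ` A)"
      by auto
  qed
  have "\<exists>\<F>. finite \<F> \<and> \<F> \<subseteq> (\<lambda>a. {Some a}) ` A \<and> (\<lambda>p. p 0) ` ?C \<subseteq> \<Union>\<F>"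
    by (rule compactinD[OF compact _ cover])
      (elim imageE, simp only: openin_Alexandroff_discrete_Some)
  then obtain \<F> where \<F>: "finite \<F>" "\<F> \<subseteq> (\<lambda>a. {Some a}) ` A" "(\<lambda>p. p 0) ` ?C \<subseteq> \<Union>\<F>"
    by (elim exE conjE)
  obtain F where F: "finite F" "F \<subseteq> A" "\<F> = (\<lambda>a. {Some a}) ` F"
    using \<F> by (meson finite_subset_image)
  show thesis
  proof (rule that[OF F(1,2)])
    fix z assume z: "z \<in> full_shift A" "initial z \<notin> Some ` F"
    have "full_shift A = truncate_seq ` (UNIV \<rightarrow> insert None (Some ` A))"
      using topspace_full_shift_topology[of A] A
      by (simp add: full_shift_topology_def PiE_UNIV_domain)
    then obtain p where p: "p \<in> UNIV \<rightarrow> insert None (Some ` A)" "z = truncate_seq p"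
      using z(1) by auto
    show "z \<in> U"
    proof (rule ccontr)
      assume "z \<notin> U"
      then have "p 0 \<in> \<Union>\<F>"
        using \<F>(3) p by blast
      then show False
        using z(2) F(3) p(2) by (auto simp: initial_truncate_seq)
    qed
  qed
qed

text \<open>The preimage under truncation restricts coordinate 0 alone, to a cofinite neighbourhood
  of infinity.\<close>

lemma openin_initial_avoids:
  assumes A: "infinite A" and F: "finite F"
  shows "openin (full_shift_topology A) {z \<in> full_shift A. initial z \<notin> Some ` F}"
proof -
  let ?K = "Alexandroff_compactification (discrete_topology A)"
  have trunc: "truncate_seq p \<in> full_shift A" if "p \<in> UNIV \<rightarrow> insert None (Some ` A)" for p
    using topspace_full_shift_topology[of A] A that
    by (auto simp: full_shift_topology_def PiE_UNIV_domain)
  \<comment> \<open>Since \<open>F\<close> may contain elements outside the alphabet, only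
    \<open>F \<inter> A\<close> is removed from \<open>A\<close>.\<close>
  have "{p \<in> UNIV \<rightarrow> insert None (Some ` A).
          truncate_seq p \<in> {z \<in> full_shift A. initial z \<notin> Some ` F}}
      = {q \<in> UNIV \<rightarrow> topspace ?K. \<forall>i<Suc 0. q i \<in> insert None (Some ` (A - (F \<inter> A)))}"
    (is "?L = ?R")
  proof (intro set_eqI iffI)
    fix p assume "p \<in> ?L"
    then have p: "p \<in> UNIV \<rightarrow> insert None (Some ` A)" "p 0 \<notin> Some ` F"
      by (simp_all add: initial_truncate_seq)
    then have "p 0 \<in> insert None (Some ` A)"
      by (simp only: Pi_iff UNIV_I)
    then show "p \<in> ?R"
      using p by auto
  next
    fix p assume "p \<in> ?R"
    then have p: "p \<in> UNIV \<rightarrow> insert None (Some ` A)"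
        "p 0 \<in> insert None (Some ` (A - (F \<inter> A)))"
      by simp_all
    then show "p \<in> ?L"
      using trunc[OF p(1)] by (auto simp: initial_truncate_seq)
  qed
  then show ?thesis
    using openin_product_cylinder[of "Suc 0" ?K "\<lambda>_. insert None (Some ` (A - (F \<inter> A)))"]
      openin_Alexandroff_discrete_cofinite[of "F \<inter> A" A] F A
    by (simp add: openin_full_shift_infinite)
qed

text \<open>For infinite \<open>A\<close>, the sets of sequences whose initial letter avoids a
  finite set form a neighbourhood basis at \<open>FinSeq []\<close>. Single letters suffice, as
  finitely many eventual properties hold eventually together. For finite \<open>A\<close>, the point
  \<open>FinSeq []\<close> is not in the space.\<close>

lemma limitin_Nil_iff:
  "limitin (full_shift_topology A) xs (FinSeq []) G \<longleftrightarrow>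
    infinite A \<and> (\<forall>\<^sub>F n in G. xs n \<in> full_shift A) \<and>
    (\<forall>a\<in>A. \<forall>\<^sub>F n in G. initial (xs n) \<noteq> Some a)"
proof
  assume lim: "limitin (full_shift_topology A) xs (FinSeq []) G"
  then have A: "infinite A"
    by (simp add: limitin_def topspace_full_shift_topology)
  have ev: "\<forall>\<^sub>F n in G. xs n \<in> {z \<in> full_shift A. initial z \<notin> Some ` F}" if "finite F" for F
    using limitinD[OF lim openin_initial_avoids[OF A that]] A by simp
  show "infinite A \<and> (\<forall>\<^sub>F n in G. xs n \<in> full_shift A) \<and>
    (\<forall>a\<in>A. \<forall>\<^sub>F n in G. initial (xs n) \<noteq> Some a)"
    using A ev[of "{}"] ev[of "{_}"] by (auto simp: eventually_conj_iff)
next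
  assume R: "infinite A \<and> (\<forall>\<^sub>F n in G. xs n \<in> full_shift A) \<and>
    (\<forall>a\<in>A. \<forall>\<^sub>F n in G. initial (xs n) \<noteq> Some a)"
  have "\<forall>\<^sub>F n in G. xs n \<in> U"
    if U: "openin (full_shift_topology A) U" "FinSeq [] \<in> U" for U
  proof -
    obtain F where F: "finite F" "F \<subseteq> A"
      "\<And>z. z \<in> full_shift A \<Longrightarrow> initial z \<notin> Some ` F \<Longrightarrow> z \<in> U"
      using full_shift_neighbourhood_Nil[OF U] by blast
    have "\<forall>\<^sub>F n in G. \<forall>a\<in>F. initial (xs n) \<noteq> Some a"
      using F(1,2) R by (intro eventually_ball_finite) auto
    moreover have "\<forall>\<^sub>F n in G. xs n \<in> full_shift A"
      using R by blast
    ultimately show ?thesis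
      by eventually_elim (use F(3) in blast)
  qed
  then show "limitin (full_shift_topology A) xs (FinSeq []) G"
    using R by (simp add: limitin_def topspace_full_shift_topology)
qed

section \<open>Blocks of shift-invariant sets\<close>

lemma map_upt_in_blocks:
  assumes "InfSeq x \<in> X"
  shows "map x [i..<j] \<in> blocks X"
proof -
  \<comment> \<open>The tail starts at \<open>i + (j - i)\<close> instead of \<open>j\<close>, so
    the decomposition also covers \<open>j < i\<close>, where the middle block is empty.\<close>
  have "prepend (map x [0..<i]) (prepend (map x [i..<j]) (InfSeq (\<lambda>k. x (i + (j - i) + k)))) = InfSeq x"
    by (auto simp: fun_eq_iff)
  then show ?thesis
    unfolding blocks_def using assms by (metis (mono_tags, lifting) mem_Collect_eq)
qed

lemma InfSeq_drop_in:
  assumes "shift ` X \<subseteq> X" and "InfSeq x \<in> X"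
  shows "InfSeq (\<lambda>j. x (i + j)) \<in> X"
proof (induction i)
  case (Suc i)
  then have "shift (InfSeq (\<lambda>j. x (i + j))) \<in> X"
    using assms(1) by blast
  then show ?case
    by simp
qed (use assms in simp)

text \<open>An element of \<open>X\<close> containing a nonempty block is nonempty, hence infinite;
  shifting it to the occurrence makes the block initial.\<close>

lemma blocks_initialE:
  assumes X: "shift ` X \<subseteq> X" "\<And>v. FinSeq v \<in> X \<Longrightarrow> v = []"
    and u: "u \<in> blocks X" "u \<noteq> []"
  obtains x where "InfSeq x \<in> X" "u = map x [0..<length u]"
proof -
  obtain w y where wy: "prepend w (prepend u y) \<in> X"
    using u(1) by (auto simp: blocks_def)
  obtain z where "y = InfSeq z"
    using wy X(2) u(2) by (cases y) auto
  then obtain x where x: "prepend w (prepend u y) = InfSeq x" "\<And>i. i < length u \<Longrightarrow> x (length w + i) = u ! i"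
    by auto
  show thesis
  proof (rule that)
    show "InfSeq (\<lambda>j. x (length w + j)) \<in> X"
      using InfSeq_drop_in[OF X(1)] wy x(1) by simp
    show "u = map (\<lambda>j. x (length w + j)) [0..<length u]"
      using x(2) by (auto intro: nth_equalityI)
  qed
qed

lemma nblocks_eq:
  assumes "shift ` X \<subseteq> X" "\<And>v. FinSeq v \<in> X \<Longrightarrow> v = []" "1 \<le> N"
  shows "nblocks N X = {map x [0..<N] |x. InfSeq x \<in> X}"
proof (intro set_eqI iffI)
  fix u assume "u \<in> nblocks N X"
  then have "u \<in> blocks X" "u \<noteq> []" "length u = N"
    using assms(3) by (auto simp: nblocks_def)
  then show "u \<in> {map x [0..<N] |x. InfSeq x \<in> X}"
    using blocks_initialE[OF assms(1,2)] by blast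
qed (auto simp: nblocks_def map_upt_in_blocks)

section \<open>Closedness in terms of infinite sequences and the empty sequence\<close>

text \<open>Each point outside \<open>C\<close> needs a neighbourhood missing \<open>C\<close>. For
  an infinite sequence, \<open>approx\<close> provides a cylinder; for a nonempty finite one,
  row-finiteness provides it; the empty sequence is outside only if it is not in the full shift at
  all.\<close>

lemma closedin_full_shiftI:
  assumes sub: "C \<subseteq> full_shift A" and fin: "\<And>u. FinSeq u \<in> C \<Longrightarrow> u = []"
    and Nil: "infinite A \<Longrightarrow> FinSeq [] \<in> C" and row: "row_finite A C"
    and approx: "\<And>x. x \<in> UNIV \<rightarrow> A \<Longrightarrow> (\<And>n. \<exists>y. InfSeq y \<in> C \<and> (\<forall>i<n. y i = x i)) \<Longrightarrow> InfSeq x \<in> C"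
  shows "closedin (full_shift_topology A) C"
proof -
  have separate: "\<exists>n. \<forall>y. InfSeq y \<in> C \<longrightarrow> (\<exists>i<n. y i \<noteq> x i)" if "x \<in> UNIV \<rightarrow> A" "InfSeq x \<notin> C" for x
    using approx[OF that(1)] that(2) by blast
  have "openin (full_shift_topology A) (full_shift A - C)"
  proof (cases "finite A")
    case True
    let ?V = "{x \<in> UNIV \<rightarrow> A. InfSeq x \<in> full_shift A - C}"
    have "\<exists>W. openin (product_topology (\<lambda>_. discrete_topology A) UNIV) W \<and> x \<in> W \<and> W \<subseteq> ?V"
      if x: "x \<in> ?V" for x
    proof -
      obtain n where n: "\<And>y. InfSeq y \<in> C \<Longrightarrow> \<exists>i<n. y i \<noteq> x i"
        using separate[of x] x by auto
      let ?W = "{y \<in> UNIV \<rightarrow> topspace (discrete_topology A). \<forall>i<n. y i \<in> {x i}}"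
      have "openin (product_topology (\<lambda>_. discrete_topology A) UNIV) ?W"
        by (rule openin_product_cylinder) (use x in auto)
      moreover have "x \<in> ?W" "?W \<subseteq> ?V"
        using x n by auto
      ultimately show ?thesis
        by blast
    qed
    then have "openin (product_topology (\<lambda>_. discrete_topology A) UNIV) ?V"
      by (subst openin_subopen) blast
    then show ?thesis
      by (simp add: openin_full_shift_finite[OF True])
  next
    case False
    let ?K = "Alexandroff_compactification (discrete_topology A)"
    let ?V = "{p \<in> UNIV \<rightarrow> insert None (Some ` A). truncate_seq p \<in> full_shift A - C}"
    have trunc: "truncate_seq p \<in> full_shift A" if "p \<in> UNIV \<rightarrow> topspace ?K" for p
      using topspace_full_shift_topology[of A] False that
      by (auto simp: full_shift_topology_def PiE_UNIV_domain)
    have "\<exists>W. openin (product_topology (\<lambda>_. ?K) UNIV) W \<and> p \<in> W \<and> W \<subseteq> ?V" if p: "p \<in> ?V" for p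
    proof (cases "truncate_seq p")
      case (FinSeq u)
      define n where "n = length u"
      have "u \<noteq> []"
        using FinSeq p Nil[OF False] by auto
      then obtain m where m: "n = Suc m"
        by (cases n) (auto simp: n_def)
      define F where "F = {b \<in> A. [u ! m, b] \<in> blocks C}"
      have uA: "set u \<subseteq> A"
        using p FinSeq by auto
      then have "u ! m \<in> A"
        using m nth_mem[of m u] by (auto simp: n_def)
      then have "finite F"
        using row by (simp add: F_def row_finite_def)
      then have op: "openin ?K (insert None (Some ` (A - F)))"
        by (intro openin_Alexandroff_discrete_cofinite) (auto simp: F_def)
      have pn: "p n = None" and pi: "\<And>i. i < n \<Longrightarrow> p i = Some (u ! i)"
        using truncate_seq_eq_FinSeqD[OF FinSeq] by (auto simp: n_def)
      \<comment> \<open>Near \<open>u\<close>, a sequence has the prefix \<open>u\<close> and continues outside the finite set of followers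
        of the last letter of \<open>u\<close>, or stops there; \<open>C\<close> allows neither.\<close>
      let ?W = "{q \<in> UNIV \<rightarrow> topspace ?K.
        \<forall>i<Suc n. q i \<in> (if i < n then {p i} else insert None (Some ` (A - F)))}"
      have "openin (product_topology (\<lambda>_. ?K) UNIV) ?W"
      proof (rule openin_product_cylinder)
        fix i
        show "openin ?K (if i < n then {p i} else insert None (Some ` (A - F)))"
          using op pi uA by (auto simp: n_def intro!: openin_Alexandroff_discrete_Some)
      qed
      moreover have "p \<in> ?W"
        using p pn by (auto simp: less_Suc_eq)
      moreover have "truncate_seq q \<notin> C" if q: "q \<in> ?W" for q
      proof
        assume C: "truncate_seq q \<in> C"
        have qi: "q i = Some (u ! i)" if "i < n" for i
          using q pi that by (auto dest!: spec[of _ i])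
        have qn: "q n \<in> insert None (Some ` (A - F))"
          using q by auto
        have "truncate_seq q \<noteq> FinSeq []"
          using qi[of 0] m by (simp add: truncate_seq_eq_Nil_iff)
        then obtain y where y: "truncate_seq q = InfSeq y"
          using C fin by (cases "truncate_seq q") auto
        then have q_eq: "q = (\<lambda>i. Some (y i))"
          by (simp add: truncate_seq_eq_InfSeq_iff)
        \<comment> \<open>This window of length 2 consists of the last letter of \<open>u\<close>,
          at position \<open>m\<close>, and the letter after it, at position \<open>n\<close>, which
          would therefore belong to \<open>F\<close>.\<close>
        have "map y [m..<Suc (Suc m)] \<in> blocks C"
          using C y by (intro map_upt_in_blocks) simp
        then have "[u ! m, y n] \<in> blocks C"
          using qi[of m] m q_eq by simp
        moreover have "y n \<in> A - F"
          using qn q_eq by auto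
        ultimately show False
          by (auto simp: F_def)
      qed
      then have "?W \<subseteq> ?V"
        using trunc by auto
      ultimately show ?thesis
        by blast
    next
      case (InfSeq x)
      then have p_eq: "p = (\<lambda>i. Some (x i))"
        by (simp add: truncate_seq_eq_InfSeq_iff)
      have x: "x \<in> UNIV \<rightarrow> A" "InfSeq x \<notin> C"
        using p InfSeq by auto
      obtain n where n: "\<And>y. InfSeq y \<in> C \<Longrightarrow> \<exists>i<n. y i \<noteq> x i"
        using separate[OF x] by blast
      \<comment> \<open>The bound \<open>Suc n\<close> fixes coordinate 0 even for
        \<open>n = 0\<close>; this excludes truncation to \<open>FinSeq []\<close>, which lies in
        \<open>C\<close>.\<close>
      let ?W = "{q \<in> UNIV \<rightarrow> topspace ?K. \<forall>i<Suc n. q i \<in> {Some (x i)}}"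
      have "openin (product_topology (\<lambda>_. ?K) UNIV) ?W"
        by (rule openin_product_cylinder)
          (use x in \<open>auto intro!: openin_Alexandroff_discrete_Some\<close>)
      moreover have "p \<in> ?W"
        using p p_eq by auto
      moreover have "truncate_seq q \<notin> C" if q: "q \<in> ?W" for q
      proof
        assume C: "truncate_seq q \<in> C"
        have qi: "q i = Some (x i)" if "i < Suc n" for i
          using q that by blast
        have "truncate_seq q \<noteq> FinSeq []"
          using qi[of 0] by (simp add: truncate_seq_eq_Nil_iff)
        then obtain y where y: "truncate_seq q = InfSeq y"
          using C fin by (cases "truncate_seq q") auto
        then have "q = (\<lambda>i. Some (y i))"
          by (simp add: truncate_seq_eq_InfSeq_iff)
        then have "\<forall>i<n. y i = x i"
          using qi by simp
        then show False
          using n[of y] C y by auto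
      qed
      then have "?W \<subseteq> ?V"
        using trunc by auto
      ultimately show ?thesis
        by blast
    qed
    then have "openin (product_topology (\<lambda>_. ?K) UNIV) ?V"
      by (subst openin_subopen) blast
    then show ?thesis
      by (simp add: openin_full_shift_infinite[OF False])
  qed
  then show ?thesis
    using sub by (simp add: closedin_def topspace_full_shift_topology)
qed

text \<open>A neighbourhood of \<open>FinSeq []\<close> disjoint from \<open>C\<close> would contain
  every sequence whose initial letter avoids some finite set, leaving only finitely many initial
  letters for \<open>C\<close>.\<close>

lemma closedin_full_shift_Nil:
  assumes C: "closedin (full_shift_topology A) C" and A: "infinite A"
    and inf: "infinite (Some -` initial ` C)"
  shows "FinSeq [] \<in> C"
proof (rule ccontr)
  assume "FinSeq [] \<notin> C"
  moreover have sub: "C \<subseteq> full_shift A" and op: "openin (full_shift_topology A) (full_shift A - C)"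
    using C by (auto simp: closedin_def topspace_full_shift_topology)
  ultimately obtain F where F: "finite F"
    "\<And>z. z \<in> full_shift A \<Longrightarrow> initial z \<notin> Some ` F \<Longrightarrow> z \<in> full_shift A - C"
    using full_shift_neighbourhood_Nil[OF op] A by (metis DiffI FinSeq_in_full_shift empty_subsetI list.set(1))
  then have "Some -` initial ` C \<subseteq> F"
    using sub by fastforce
  then show False
    using inf F(1) finite_subset by blast
qed

section \<open>Finiteness and infinitude of sets of blocks\<close>

lemma InfSeq_entry_in:
  assumes "X \<subseteq> full_shift A" "InfSeq x \<in> X"
  shows "x i \<in> A"
  using assms InfSeq_in_full_shift[of x A] by blast

text \<open>By induction on the length: a block is prolonged by a follower of its last letter, and
  row-finiteness leaves finitely many of these. The induction starts at length 1, so that a last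
  letter exists.\<close>

lemma finite_nblocks_hd:
  assumes X: "X \<subseteq> full_shift A" "row_finite A X" "shift ` X \<subseteq> X" "\<And>v. FinSeq v \<in> X \<Longrightarrow> v = []"
    and N: "1 \<le> N"
  shows "finite {u \<in> nblocks N X. hd u = a}"
proof -
  have XA: "x i \<in> A" if "InfSeq x \<in> X" for x i
    using InfSeq_entry_in[OF X(1) that] .
  have "finite {map x [0..<Suc n] |x. InfSeq x \<in> X \<and> x 0 = a}" for n
  proof (induction n)
    case 0
    have "{map x [0..<Suc 0] |x. InfSeq x \<in> X \<and> x 0 = a} \<subseteq> {[a]}"
      by auto
    then show ?case
      by (rule finite_subset) simp
  next
    case (Suc n)
    let ?P = "{map x [0..<Suc n] |x. InfSeq x \<in> X \<and> x 0 = a}"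
    let ?Q = "\<Union>u\<in>?P. (\<lambda>c. u @ [c]) ` {c \<in> A. [last u, c] \<in> blocks X}"
    have "{map x [0..<Suc (Suc n)] |x. InfSeq x \<in> X \<and> x 0 = a} \<subseteq> ?Q"
    proof clarify
      fix x assume x: "InfSeq x \<in> X" "a = x 0"
      have "[x n, x (Suc n)] \<in> blocks X"
        using map_upt_in_blocks[OF x(1), of n "Suc (Suc n)"] by simp
      then have "x (Suc n) \<in> {c \<in> A. [last (map x [0..<Suc n]), c] \<in> blocks X}"
        using XA[OF x(1)] by simp
      moreover have "map x [0..<Suc (Suc n)] = map x [0..<Suc n] @ [x (Suc n)]"
        by simp
      moreover have "map x [0..<Suc n] \<in> {map y [0..<Suc n] |y. InfSeq y \<in> X \<and> y 0 = x 0}"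
        using x by blast
      ultimately show "map x [0..<Suc (Suc n)] \<in>
          (\<Union>u\<in>{map y [0..<Suc n] |y. InfSeq y \<in> X \<and> y 0 = x 0}.
            (\<lambda>c. u @ [c]) ` {c \<in> A. [last u, c] \<in> blocks X})"
        by blast
    qed
    moreover have "finite ?Q"
    proof (rule finite_UN_I[OF Suc])
      fix u assume "u \<in> ?P"
      then have "last u \<in> A"
        using XA by auto
      then show "finite ((\<lambda>c. u @ [c]) ` {c \<in> A. [last u, c] \<in> blocks X})"
        using X(2) by (intro finite_imageI) (simp add: row_finite_def)
    qed
    ultimately show ?case
      by (rule finite_subset)
  qed
  moreover obtain n where "N = Suc n"
    using N by (cases N) auto
  moreover from this have "{u \<in> nblocks N X. hd u = a} \<subseteq> {map x [0..<Suc n] |x. InfSeq x \<in> X \<and> x 0 = a}"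
    using nblocks_eq[OF X(3,4) N] by (auto simp: hd_map simp del: upt_Suc)
  ultimately show ?thesis
    using finite_subset by blast
qed

text \<open>Finitely many letters form only finitely many words of length \<open>N\<close>, so
  infinitely many letters occur in \<open>X\<close>. After shifting, each occurs as an initial
  letter, and closedness of \<open>X\<close> applies.\<close>

lemma infinite_nblocks_Nil_in:
  assumes X: "shift_space A X" "\<And>v. FinSeq v \<in> X \<Longrightarrow> v = []"
    and N: "1 \<le> N" and inf: "infinite (nblocks N X)"
  shows "infinite A" "FinSeq [] \<in> X"
proof -
  have shift: "shift ` X \<subseteq> X" and closed: "closedin (full_shift_topology A) X"
    using X(1) by (auto simp: shift_space_def)
  let ?L = "Some -` initial ` X"
  have "x i \<in> ?L" if "InfSeq x \<in> X" for x i
    using InfSeq_drop_in[OF shift that, of i] by (force simp: image_iff)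
  then have "nblocks N X \<subseteq> {u. set u \<subseteq> ?L \<and> length u = N}"
    using nblocks_eq[OF shift X(2) N] by auto
  then have L: "infinite ?L"
    using inf finite_lists_length_eq[of ?L N] finite_subset by blast
  have "initial z \<in> insert None (Some ` A)" if "z \<in> full_shift A" for z
    using that by (cases z) (auto dest: hd_in_set)
  then have "?L \<subseteq> A"
    using closedin_subset[OF closed] by (fastforce simp: topspace_full_shift_topology)
  then show "infinite A"
    using L finite_subset by blast
  then show "FinSeq [] \<in> X"
    using closedin_full_shift_Nil[OF closed _ L] by blast
qed

section \<open>The higher block presentation as a row-finite shift space\<close>

lemma InfSeq_in_higher_block_presentation:
  "InfSeq s \<in> higher_block_presentation N X \<longleftrightarrow>
    (\<exists>x. InfSeq x \<in> X \<and> s = (\<lambda>i. map x [i..<i + N]))"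
  unfolding higher_block_presentation_def
proof
  assume "InfSeq s \<in> higher_block_code N ` X"
  then obtain z where "z \<in> X" "InfSeq s = higher_block_code N z"
    by blast
  then show "\<exists>x. InfSeq x \<in> X \<and> s = (\<lambda>i. map x [i..<i + N])"
    by (cases z) auto
qed force

lemma FinSeq_in_higher_block_presentation:
  "FinSeq u \<in> higher_block_presentation N X \<longleftrightarrow> u = [] \<and> (\<exists>v. FinSeq v \<in> X)"
  unfolding higher_block_presentation_def
proof
  assume "FinSeq u \<in> higher_block_code N ` X"
  then obtain z where "z \<in> X" "FinSeq u = higher_block_code N z"
    by blast
  then show "u = [] \<and> (\<exists>v. FinSeq v \<in> X)"
    by (cases z) auto
qed force

lemma shift_higher_block_code:
  "shift (higher_block_code N z) = higher_block_code N (shift z)"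
proof -
  have "map x [Suc i..<Suc i + N] = map (\<lambda>j. x (Suc j)) [i..<i + N]" for x :: "nat \<Rightarrow> 'a" and i
    by (rule nth_equalityI) (simp_all del: upt_Suc)
  then show ?thesis
    by (cases z) (simp_all del: upt_Suc)
qed

text \<open>The first letter of the block at position \<open>i\<close> recovers the entry at
  \<open>i\<close>.\<close>

lemma inj_on_higher_block_code:
  assumes "1 \<le> N" and "\<And>v. FinSeq v \<in> X \<Longrightarrow> v = []"
  shows "inj_on (higher_block_code N) X"
proof (rule inj_onI)
  fix y z assume yz: "y \<in> X" "z \<in> X" "higher_block_code N y = higher_block_code N z"
  have hd: "hd (map x [i..<i + N]) = x i" for x :: "nat \<Rightarrow> 'a" and i
    using assms(1) by (simp add: hd_map)
  show "y = z"
  proof (cases y)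
    case (FinSeq u)
    then show ?thesis
      using yz assms(2) by (cases z) auto
  next
    case (InfSeq x)
    then obtain x' where z: "z = InfSeq x'"
      using yz(3) by (cases z) auto
    then have "map x [i..<i + N] = map x' [i..<i + N]" for i
      using yz(3) InfSeq by (simp add: fun_eq_iff)
    then have "x = x'"
      using hd by (metis ext)
    then show ?thesis
      using InfSeq z by simp
  qed
qed

text \<open>If \<open>c\<close> follows \<open>b\<close>, both are consecutive windows of one
  sequence in \<open>X\<close>, so \<open>hd c\<close> follows \<open>hd b\<close> there. This
  leaves finitely many values of \<open>hd c\<close>, each the head of finitely many blocks.\<close>

lemma row_finite_higher_block_presentation:
  assumes X: "X \<subseteq> full_shift A" "row_finite A X" "shift ` X \<subseteq> X" "\<And>v. FinSeq v \<in> X \<Longrightarrow> v = []"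
    and N: "1 \<le> N"
  shows "row_finite (nblocks N X) (higher_block_presentation N X)"
  unfolding row_finite_def
proof
  let ?H = "higher_block_presentation N X"
  fix b assume "b \<in> nblocks N X"
  then obtain w where w: "InfSeq w \<in> X" "b = map w [0..<N]"
    using nblocks_eq[OF X(3,4) N] by blast
  have "hd b \<in> A"
    using InfSeq_entry_in[OF X(1) w(1)] w(2) N by (simp add: hd_map)
  then have fin: "finite {a \<in> A. [hd b, a] \<in> blocks X}"
    using X(2) by (auto simp: row_finite_def)
  have shiftH: "shift ` ?H \<subseteq> ?H"
    using X(3) by (auto simp: higher_block_presentation_def shift_higher_block_code)
  have "{c \<in> nblocks N X. [b, c] \<in> blocks ?H}
      \<subseteq> (\<Union>a\<in>{a \<in> A. [hd b, a] \<in> blocks X}. {u \<in> nblocks N X. hd u = a})"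
  proof
    fix c assume c: "c \<in> {c \<in> nblocks N X. [b, c] \<in> blocks ?H}"
    then obtain s where s: "InfSeq s \<in> ?H" "[b, c] = map s [0..<length [b, c]]"
      using blocks_initialE[OF shiftH, of "[b, c]"] FinSeq_in_higher_block_presentation[of _ N X]
      by blast
    then obtain x where x: "InfSeq x \<in> X" "s = (\<lambda>i. map x [i..<i + N])"
      using InfSeq_in_higher_block_presentation by blast
    have "b = map x [0..<0 + N]" "c = map x [1..<1 + N]"
      using s(2) x(2) by (simp_all add: upt_rec[of _ 2])
    then have "hd b = x 0" "hd c = x 1"
      using N by (simp_all add: hd_map del: upt_Suc)
    moreover have "[x 0, x 1] \<in> blocks X"
      using map_upt_in_blocks[OF x(1), of 0 2] by (simp add: upt_rec)
    moreover have "x 1 \<in> A"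
      using InfSeq_entry_in[OF X(1) x(1)] .
    ultimately show "c \<in> (\<Union>a\<in>{a \<in> A. [hd b, a] \<in> blocks X}. {u \<in> nblocks N X. hd u = a})"
      using c by simp
  qed
  then show "finite {c \<in> nblocks N X. [b, c] \<in> blocks ?H}"
    by (rule finite_subset) (use fin finite_nblocks_hd[OF X N] in auto)
qed

text \<open>Shift invariance holds because the code commutes with the shift. Infinite extension
  concerns only \<open>FinSeq []\<close>, and closedness follows from
  \<open>closedin_full_shiftI\<close>.\<close>

lemma shift_space_higher_block_presentation:
  assumes X: "shift_space A X" "row_finite A X" and N: "1 \<le> N"
  shows "shift_space (nblocks N X) (higher_block_presentation N X)"
proof -
  let ?H = "higher_block_presentation N X"
  let ?B = "nblocks N X"
  have closed: "closedin (full_shift_topology A) X" and shift: "shift ` X \<subseteq> X"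
    using X(1) by (auto simp: shift_space_def)
  have sub: "X \<subseteq> full_shift A"
    using closedin_subset[OF closed] by (simp add: topspace_full_shift_topology)
  have fin: "\<And>v. FinSeq v \<in> X \<Longrightarrow> v = []"
    using row_finite_FinSeq_eq_Nil[OF X] .
  have block: "map x [i..<i + N] \<in> ?B" if "InfSeq x \<in> X" for x i
    using map_upt_in_blocks[OF that] by (simp add: nblocks_def)
  have shiftH: "shift ` ?H \<subseteq> ?H"
    using shift by (auto simp: higher_block_presentation_def shift_higher_block_code)
  have extend: "infinite {b \<in> ?B. \<exists>y \<in> full_shift ?B. prepend u (prepend [b] y) \<in> ?H}"
    if "FinSeq u \<in> ?H" for u
  proof -
    let ?E = "{a \<in> A. \<exists>y \<in> full_shift A. prepend [] (prepend [a] y) \<in> X}"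
    let ?G = "{b \<in> ?B. \<exists>y \<in> full_shift ?B. prepend u (prepend [b] y) \<in> ?H}"
    have u: "u = []" "FinSeq [] \<in> X"
      using that fin by (auto simp: FinSeq_in_higher_block_presentation)
    \<comment> \<open>Each letter that can start a sequence in \<open>X\<close> is the head of a
      block that can start one in \<open>?H\<close>; so \<open>?G\<close> is infinite because
      \<open>?E\<close> is.\<close>
    have "?E \<subseteq> hd ` ?G"
    proof clarify
      fix a y assume a: "a \<in> A" "prepend [] (prepend [a] y) \<in> X"
      then obtain z where "y = InfSeq z"
        using fin by (cases y) auto
      then obtain x where x: "InfSeq x \<in> X" "x 0 = a"
        using a(2) by auto
      have "prepend u (prepend [map x [0..<0 + N]] (InfSeq (\<lambda>i. map x [Suc i..<Suc i + N])))
          = InfSeq (\<lambda>i. map x [i..<i + N])"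
        using u by (auto simp: fun_eq_iff simp del: upt_Suc)
      then have "prepend u (prepend [map x [0..<0 + N]] (InfSeq (\<lambda>i. map x [Suc i..<Suc i + N]))) \<in> ?H"
        using x(1) by (simp only: InfSeq_in_higher_block_presentation) blast
      moreover have "InfSeq (\<lambda>i. map x [Suc i..<Suc i + N]) \<in> full_shift ?B"
        using block[OF x(1)] by (simp del: upt_Suc add_Suc)
      ultimately have G: "map x [0..<0 + N] \<in> ?G"
        using block[OF x(1), of 0] by blast
      have hd: "hd (map x [0..<0 + N]) = a"
        using x(2) N by (simp add: hd_map)
      show "a \<in> hd ` ?G"
        using imageI[OF G, of hd] unfolding hd .
    qed
    moreover have "infinite ?E"
      using X(1) u(2) unfolding shift_space_def by blast
    ultimately show ?thesis
      using finite_surj by blast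
  qed
  have "closedin (full_shift_topology ?B) ?H"
  proof (rule closedin_full_shiftI)
    have Nil: "FinSeq [] \<in> X" if "infinite ?B"
      using infinite_nblocks_Nil_in(2)[OF X(1) fin N that] .
    then show "FinSeq [] \<in> ?H" if "infinite ?B"
      using that by (auto simp: FinSeq_in_higher_block_presentation)
    show "?H \<subseteq> full_shift ?B"
    proof
      fix z assume z: "z \<in> ?H"
      show "z \<in> full_shift ?B"
      proof (cases z)
        case (FinSeq u)
        \<comment> \<open>The alphabet is infinite because \<open>extend\<close> finds infinitely
          many of its letters that can follow \<open>u\<close>.\<close>
        then have "u = []" "infinite ?B"
          using z extend[of u] by (auto simp: FinSeq_in_higher_block_presentation)
        then show ?thesis
          using FinSeq by simp
      next
        case (InfSeq s)
        then show ?thesis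
          using z block by (auto simp: InfSeq_in_higher_block_presentation)
      qed
    qed
    show "u = []" if "FinSeq u \<in> ?H" for u
      using that by (simp add: FinSeq_in_higher_block_presentation)
    show "row_finite ?B ?H"
      using row_finite_higher_block_presentation[OF sub X(2) shift fin N] .
    fix s assume s: "\<And>n. \<exists>t. InfSeq t \<in> ?H \<and> (\<forall>i<n. t i = s i)"
    have approx: "\<exists>x. InfSeq x \<in> X \<and> (\<forall>i<n. s i = map x [i..<i + N])" for n
      using s[of n] by (auto simp: InfSeq_in_higher_block_presentation)
    \<comment> \<open>The candidate preimage of \<open>s\<close> under the code consists of the
      first letters of the entries of \<open>s\<close>.\<close>
    define x where "x i = hd (s i)" for i
    have approx_x: "\<exists>y. InfSeq y \<in> X \<and> (\<forall>i<n. s i = map y [i..<i + N] \<and> y i = x i)" for n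
      using approx[of n] N by (fastforce simp: x_def hd_map)
    have "x i \<in> A" for i
    proof -
      obtain y where "InfSeq y \<in> X" "y i = x i"
        using approx_x[of "Suc i"] by auto
      then show ?thesis
        using InfSeq_entry_in[OF sub] by metis
    qed
    then have "InfSeq x \<in> X"
      using approx_x by (intro closedin_full_shift_approx[OF closed]) blast+
    moreover have "s i = map x [i..<i + N]" for i
    proof -
      \<comment> \<open>Agreement below \<open>i + N\<close> covers the whole window that starts at
        \<open>i\<close>.\<close>
      obtain y where "\<forall>j<i + N. s j = map y [j..<j + N] \<and> y j = x j"
        using approx_x by blast
      then show ?thesis
        using N by simp
    qed
    ultimately show "InfSeq s \<in> ?H"
      by (auto simp: InfSeq_in_higher_block_presentation)
  qed
  then show ?thesis
    using shiftH extend by (simp add: shift_space_def)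
qed

section \<open>Countability, limits and the induced 1-block code\<close>

lemma countable_nblocks:
  assumes "countable A" "X \<subseteq> full_shift A" "shift ` X \<subseteq> X" "\<And>v. FinSeq v \<in> X \<Longrightarrow> v = []" "1 \<le> N"
  shows "countable (nblocks N X)"
proof (rule countable_subset)
  show "nblocks N X \<subseteq> lists A"
  proof
    fix u assume "u \<in> nblocks N X"
    then obtain x where x: "InfSeq x \<in> X" "u = map x [0..<N]"
      using nblocks_eq[OF assms(3-5)] by blast
    then show "u \<in> lists A"
      using InfSeq_entry_in[OF assms(2)] by auto
  qed
qed (use assms(1) in simp)

text \<open>If \<open>xs n\<close> starts with \<open>a\<close>, then its code starts with one of
  the finitely many blocks with head \<open>a\<close>, each of which is eventually avoided.\<close>

lemma limitin_Nil_higher_block_code: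
  assumes X: "shift_space A X" "row_finite A X" and N: "1 \<le> N" and xs: "range xs \<subseteq> X"
    and lim: "limitin (full_shift_topology (nblocks N X)) (\<lambda>n. higher_block_code N (xs n)) (FinSeq []) G"
  shows "limitin (full_shift_topology A) xs (FinSeq []) G"
proof -
  have closed: "closedin (full_shift_topology A) X" and shift: "shift ` X \<subseteq> X"
    using X(1) by (auto simp: shift_space_def)
  have sub: "X \<subseteq> full_shift A"
    using closedin_subset[OF closed] by (simp add: topspace_full_shift_topology)
  have fin: "\<And>v. FinSeq v \<in> X \<Longrightarrow> v = []"
    using row_finite_FinSeq_eq_Nil[OF X] .
  have "infinite A"
    using lim infinite_nblocks_Nil_in(1)[OF X(1) fin N] by (simp add: limitin_Nil_iff)
  moreover have "\<forall>\<^sub>F n in G. initial (xs n) \<noteq> Some a" for a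
  proof -
    let ?F = "{u \<in> nblocks N X. hd u = a}"
    have "\<forall>\<^sub>F n in G. \<forall>b\<in>?F. initial (higher_block_code N (xs n)) \<noteq> Some b"
      using finite_nblocks_hd[OF sub X(2) shift fin N] lim
      by (intro eventually_ball_finite) (auto simp: limitin_Nil_iff)
    then show ?thesis
    proof (rule eventually_mono, intro notI)
      fix n assume *: "\<forall>b\<in>?F. initial (higher_block_code N (xs n)) \<noteq> Some b"
        and a: "initial (xs n) = Some a"
      have "xs n \<in> X"
        using xs by blast
      then obtain x where x: "xs n = InfSeq x" "x 0 = a" "InfSeq x \<in> X"
        using a fin by (cases "xs n") auto
      then have "map x [0..<0 + N] \<in> ?F"
        using N nblocks_eq[OF shift fin N] by (auto simp: hd_map)
      then show False
        using * x(1) by auto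
    qed
  qed
  moreover have "xs n \<in> full_shift A" for n
    using xs sub by blast
  ultimately show ?thesis
    by (simp add: limitin_Nil_iff)
qed

theorem proposition7p9:
  fixes A :: "'a set" and X Y :: "'a fiseq set"
    and M :: nat and \<psi> :: "'a fiseq \<Rightarrow> 'a fiseq"
  assumes "countable A"
    and "shift_space A X" and "shift_space A Y"
    and "row_finite A X"
    and "1 \<le> M" and "block_code M A X A Y \<psi>"
  shows "\<exists>\<psi>M :: 'a list fiseq \<Rightarrow> 'a fiseq.
    block_code 1 (nblocks M X) (higher_block_presentation M X) A Y \<psi>M \<and>
    (\<forall>x\<in>X. (\<psi>M \<circ> higher_block_code M) x = \<psi> x)"
proof -
  let ?H = "higher_block_presentation M X"
  let ?B = "nblocks M X"
  have closed: "closedin (full_shift_topology A) X" and shift: "shift ` X \<subseteq> X"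
    using assms(2) by (auto simp: shift_space_def)
  have sub: "X \<subseteq> full_shift A"
    using closedin_subset[OF closed] by (simp add: topspace_full_shift_topology)
  have fin: "\<And>v. FinSeq v \<in> X \<Longrightarrow> v = []"
    using row_finite_FinSeq_eq_Nil[OF assms(2,4)] .
  have shiftH: "shift_space ?B ?H"
    using shift_space_higher_block_presentation[OF assms(2,4,5)] .
  have rowH: "row_finite ?B ?H"
    using row_finite_higher_block_presentation[OF sub assms(4) shift fin assms(5)] .
  obtain \<Phi> where \<Phi>: "\<Phi> \<in> ?B \<rightarrow> A"
    "\<And>x. InfSeq x \<in> X \<Longrightarrow> \<psi> (InfSeq x) = InfSeq (\<lambda>i. \<Phi> (map x [i..<i + M]))"
    using assms(6) unfolding block_code_def by blast
  have \<psi>: "\<psi> \<in> X \<rightarrow> Y" and lim: "\<And>xs. range xs \<subseteq> X \<Longrightarrow>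
      limitin (full_shift_topology A) xs (FinSeq []) sequentially \<Longrightarrow>
      limitin (full_shift_topology A) (\<lambda>n. \<psi> (xs n)) (FinSeq []) sequentially"
    using assms(6) unfolding block_code_def by blast+
  define \<theta> where "\<theta> = inv_into X (higher_block_code M)"
  have \<theta>: "\<theta> (higher_block_code M x) = x" if "x \<in> X" for x
    unfolding \<theta>_def using inj_on_higher_block_code[OF assms(5) fin] that by (rule inv_into_f_f)
  have \<theta>_in: "\<theta> z \<in> X" "higher_block_code M (\<theta> z) = z" if "z \<in> ?H" for z
    using that \<theta> by (auto simp: higher_block_presentation_def)
  have "block_code 1 ?B ?H A Y (\<psi> \<circ> \<theta>)"
    unfolding block_code_def
  proof (intro conjI allI impI)
    show "countable ?B"
      using countable_nblocks[OF assms(1) sub shift fin assms(5)] .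
    show "\<psi> \<circ> \<theta> \<in> ?H \<rightarrow> Y"
      using \<psi> \<theta>_in(1) by auto
    show "limitin (full_shift_topology A) (\<lambda>n. (\<psi> \<circ> \<theta>) (zs n)) (FinSeq []) sequentially"
      if zs: "range zs \<subseteq> ?H \<and> limitin (full_shift_topology ?B) zs (FinSeq []) sequentially" for zs
    proof -
      have zsH: "zs n \<in> ?H" for n
        using zs by blast
      then have "range (\<lambda>n. \<theta> (zs n)) \<subseteq> X"
        using \<theta>_in(1) by blast
      \<comment> \<open>By \<open>\<theta>_in(2)\<close>, \<open>zs n\<close> is the code of
        \<open>\<theta> (zs n)\<close>, which is the form that the lemma on limits of codes
        expects.\<close>
      moreover have "limitin (full_shift_topology A) (\<lambda>n. \<theta> (zs n)) (FinSeq []) sequentially"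
        using zs \<theta>_in(2)[OF zsH] calculation
        by (intro limitin_Nil_higher_block_code[OF assms(2,4,5)]) auto
      ultimately show ?thesis
        using lim by simp
    qed
    show "\<exists>\<Phi>'. \<Phi>' \<in> nblocks 1 ?H \<rightarrow> A \<and>
        (\<forall>s. InfSeq s \<in> ?H \<longrightarrow> (\<psi> \<circ> \<theta>) (InfSeq s) = InfSeq (\<lambda>i. \<Phi>' (map s [i..<i + 1])))"
    proof (intro exI conjI allI impI)
      \<comment> \<open>A 1-block over \<open>?B\<close> is a one-element list whose entry is itself
        an \<open>M\<close>-block; \<open>hd\<close> unwraps it for \<open>\<Phi>\<close>.\<close>
      show "\<Phi> \<circ> hd \<in> nblocks 1 ?H \<rightarrow> A"
      proof
        fix u assume u: "u \<in> nblocks 1 ?H"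
        have "shift ` ?H \<subseteq> ?H"
          using shiftH by (simp add: shift_space_def)
        then obtain s where "InfSeq s \<in> ?H" "u = map s [0..<1]"
          using u nblocks_eq[of ?H 1] row_finite_FinSeq_eq_Nil[OF shiftH rowH] by blast
        then obtain x where "InfSeq x \<in> X" "hd u = map x [0..<M]"
          by (auto simp: InfSeq_in_higher_block_presentation)
        then have "hd u \<in> ?B"
          using nblocks_eq[OF shift fin assms(5)] by blast
        then show "(\<Phi> \<circ> hd) u \<in> A"
          using \<Phi>(1) by auto
      qed
      fix s assume "InfSeq s \<in> ?H"
      then obtain x where x: "InfSeq x \<in> X" "s = (\<lambda>i. map x [i..<i + M])"
        using InfSeq_in_higher_block_presentation by blast
      then have "\<theta> (InfSeq s) = InfSeq x"
        using \<theta>[OF x(1)] by simp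
      then show "(\<psi> \<circ> \<theta>) (InfSeq s) = InfSeq (\<lambda>i. (\<Phi> \<circ> hd) (map s [i..<i + 1]))"
        using \<Phi>(2)[OF x(1)] x(2) by simp
    qed
  qed (use assms(1,3) shiftH rowH in simp_all)
  moreover have "\<forall>x\<in>X. ((\<psi> \<circ> \<theta>) \<circ> higher_block_code M) x = \<psi> x"
    using \<theta> by simp
  ultimately show ?thesis
    by blast
qed

end
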